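(* Let $q$ be a prime power and $a,b,d,d_1,d_2,u$ positive integers with $2d\le d_1+d_2$. Then $\Lambda(q,a,b,d,u)\ge\min\{A_q(a,d_1;u),A_q(b,d_2;u)\}$.
   Context: $\Lambda(q,a,b,d,u)$ is the maximum size of a set of $a\times b$ matrices over $\mathbb{F}_q$ such that any two distinct elements $X,Y$ satisfy $\mathrm{rk}(X-Y)\ge d$ and every element has rank at most $u$. $A_q(v,d;k)$ is the maximum number of $k$-dimensional subspaces of $\mathbb{F}_q^v$ with pairwise subspace distance $\dim(U+W)-\dim(U\cap W)$ at least $d$. *)

theory Defs
  imports "HOL-Analysis.Cartesian_Space"
begin

text \<open>
  The field with \<open>q\<close> elements is a type \<open>'f\<close> of classes \<open>field\<close> and \<open>finite\<close>, where
  \<open>q = CARD('f)\<close>. An \<open>a \<times> b\<close> matrix (\<open>a\<close> rows, \<open>b\<close> columns) has type \<open>'f ^ 'b ^ 'a\<close> with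
  \<open>a = CARD('a)\<close> and \<open>b = CARD('b)\<close>; the ambient space of dimension \<open>v = CARD('v)\<close> is
  \<open>'f ^ 'v\<close>.
\<close>

definition bounded_rank_code :: "nat \<Rightarrow> nat \<Rightarrow> ('f::{field,finite} ^ 'b ^ 'a) set \<Rightarrow> bool" where
  "bounded_rank_code d u C \<longleftrightarrow>
     (\<forall>X\<in>C. \<forall>Y\<in>C. X \<noteq> Y \<longrightarrow> d \<le> rank (X - Y)) \<and> (\<forall>X\<in>C. rank X \<le> u)"

definition Lambda ::
    "'f::{field,finite} itself \<Rightarrow> 'a::finite itself \<Rightarrow> 'b::finite itself \<Rightarrow> nat \<Rightarrow> nat \<Rightarrow> nat" where
  "Lambda _ _ _ d u = Max {card C | C :: ('f ^ 'b ^ 'a) set. bounded_rank_code d u C}"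

text \<open>The subtraction does not truncate, since the intersection is contained in the sum.\<close>

definition subspace_dist :: "('f::field ^ 'v) set \<Rightarrow> ('f ^ 'v) set \<Rightarrow> nat" where
  "subspace_dist U W = vec.dim {x + y | x y. x \<in> U \<and> y \<in> W} - vec.dim (U \<inter> W)"

definition const_dim_code :: "nat \<Rightarrow> nat \<Rightarrow> ('f::{field,finite} ^ 'v) set set \<Rightarrow> bool" where
  "const_dim_code d k C \<longleftrightarrow>
     (\<forall>U\<in>C. vec.subspace U \<and> vec.dim U = k) \<and>
     (\<forall>U\<in>C. \<forall>W\<in>C. U \<noteq> W \<longrightarrow> d \<le> subspace_dist U W)"

definition A_code :: "'f::{field,finite} itself \<Rightarrow> 'v::finite itself \<Rightarrow> nat \<Rightarrow> nat \<Rightarrow> nat" where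
  "A_code _ _ d k = Max {card C | C :: ('f ^ 'v) set set. const_dim_code d k C}"

text \<open>Both maxima range over finite nonempty sets, so \<open>Max\<close> is a genuine maximum.\<close>

lemma Lambda_range_ok:
  "finite {card C | C :: ('f::{field,finite} ^ 'b::finite ^ 'a::finite) set. bounded_rank_code d u C}"
  "{card C | C :: ('f ^ 'b ^ 'a) set. bounded_rank_code d u C} \<noteq> {}"
proof -
  show "finite {card C | C :: ('f ^ 'b ^ 'a) set. bounded_rank_code d u C}"
    by simp
  have "bounded_rank_code d u ({} :: ('f ^ 'b ^ 'a) set)"
    by (simp add: bounded_rank_code_def)
  then show "{card C | C :: ('f ^ 'b ^ 'a) set. bounded_rank_code d u C} \<noteq> {}"
    by blast
qed

lemma A_code_range_ok:
  "finite {card C | C :: ('f::{field,finite} ^ 'v::finite) set set. const_dim_code d k C}"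
  "{card C | C :: ('f ^ 'v) set set. const_dim_code d k C} \<noteq> {}"
proof -
  show "finite {card C | C :: ('f ^ 'v) set set. const_dim_code d k C}"
    by simp
  have "const_dim_code d k ({} :: ('f ^ 'v) set set)"
    by (simp add: const_dim_code_def)
  then show "{card C | C :: ('f ^ 'v) set set. const_dim_code d k C} \<noteq> {}"
    by blast
qed

end

theory Submission imports Defs begin

text \<open>
  Pair the codewords \<open>U\<close> of one subspace code with the codewords \<open>W\<close> of the other one, and let \<open>X\<close>
  be a matrix whose row action \<open>x \<mapsto> x X\<close> has range inside \<open>W\<close> and kernel the annihilator of \<open>U\<close>.
  If \<open>X'\<close> belongs to another pair \<open>(U', W')\<close>, then \<open>X\<close> maps the kernel of \<open>X - X'\<close> into
  \<open>W \<inter> W'\<close>, and the kernel of this restriction annihilates \<open>U + U'\<close>. Rank-nullity gives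
  \<open>rk (X - X') \<ge> dim (U + U') - dim (W \<inter> W')\<close>, which is half the sum of the two subspace
  distances.
\<close>

text \<open>One half of rank-nullity, restricted to a subspace \<open>V\<close>. A basis
  \<open>K\<close> of the kernel in \<open>V\<close>, together with lifts \<open>D\<close> of a
  basis of the image, spans \<open>V\<close>: a vector and the lift of its image differ by a kernel
  element.\<close>

lemma dim_le_dim_image_plus_dim_kernel:
  fixes f :: "'f::field ^ 'n \<Rightarrow> 'f ^ 'm"
  assumes lf: "Vector_Spaces.linear (*s) (*s) f" and V: "vec.subspace V"
  shows "vec.dim V \<le> vec.dim (f ` V) + vec.dim {x \<in> V. f x = 0}"
proof -
  interpret f: Vector_Spaces.linear "(*s)" "(*s)" f by (rule lf)
  obtain K where K: "K \<subseteq> {x \<in> V. f x = 0}" "vec.independent K" "{x \<in> V. f x = 0} \<subseteq> vec.span K"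
    "card K = vec.dim {x \<in> V. f x = 0}"
    by (rule vec.basis_exists)
  obtain C where C: "C \<subseteq> f ` V" "vec.independent C" "f ` V \<subseteq> vec.span C"
    "card C = vec.dim (f ` V)"
    by (rule vec.basis_exists)
  obtain D where D: "D \<subseteq> V" "C = f ` D" "inj_on f D"
    using subset_image_inj[THEN iffD1, OF C(1)] by blast
  have finK: "finite K" and finC: "finite C"
    using K(2) C(2) vec.finiteI_independent by auto
  have finD: "finite D"
    using finC D(2,3) finite_imageD by blast
  have "V \<subseteq> vec.span (K \<union> D)"
  proof
    fix v assume v: "v \<in> V"
    then have "f v \<in> f ` vec.span D"
      using C(3) D(2) f.span_image by auto
    then obtain w where w: "w \<in> vec.span D" "f v = f w"
      by auto
    have "w \<in> V"
      using w(1) D(1) V vec.span_minimal by blast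
    then have "v - w \<in> vec.span K"
      using K(3) v w(2) V by (auto simp: vec.subspace_diff f.diff)
    then have "(v - w) + w \<in> vec.span (K \<union> D)"
      using w(1) vec.span_mono[OF sup_ge1, of K D] vec.span_mono[OF sup_ge2, of D K]
      by (intro vec.span_add) auto
    then show "v \<in> vec.span (K \<union> D)"
      by simp
  qed
  then have "vec.dim V \<le> card (K \<union> D)"
    using finK finD by (simp add: vec.dim_le_card)
  also have "\<dots> \<le> card K + card D"
    by (rule card_Un_le)
  also have "card D = card C"
    using D(2,3) by (simp add: card_image)
  finally show ?thesis
    using K(4) C(4) by simp
qed

text \<open>Keeps the row action in the form \<open>transpose X *v x\<close>, so that facts about
  \<open>*v\<close> apply to it; the rule would turn it into \<open>x v* X\<close>.\<close>

declare transpose_matrix_vector [simp del]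

text \<open>\<open>rank\<close> is the dimension of the set of rows. Each row is the image of a unit
  vector under the row action, and every image is a combination of rows.\<close>

lemma rank_eq_dim_range_transpose:
  fixes A :: "'f::field ^ 'n ^ 'm"
  shows "rank A = vec.dim (range ((*v) (transpose A)))"
proof -
  have "rows A \<subseteq> range ((*v) (transpose A))"
  proof
    fix r assume "r \<in> rows A"
    then obtain i where "r = row i A"
      by (auto simp: rows_def)
    then have "r = transpose A *v axis i 1"
      by (simp add: vec_eq_iff row_def matrix_vector_mult_def transpose_def axis_def if_distrib
          cong: if_cong)
    then show "r \<in> range ((*v) (transpose A))"
      by blast
  qed
  moreover have "range ((*v) (transpose A)) \<subseteq> vec.span (rows A)"
    using matrix_vector_mult_in_columnspace_gen[of "transpose A"] by auto
  ultimately show ?thesis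
    unfolding row_rank_def_gen by (intro antisym vec.dim_subset vec.dim_mono)
qed

text \<open>The standard bilinear form. Over a finite field a nonzero vector may be orthogonal to
  itself, so the annihilator of a subspace need not be a complement of it.\<close>

definition vdot :: "'f::comm_ring_1 ^ 'n \<Rightarrow> 'f ^ 'n \<Rightarrow> 'f" where
  "vdot s x = (\<Sum>i\<in>UNIV. s $ i * x $ i)"

definition annihilator :: "('f::comm_ring_1 ^ 'n) set \<Rightarrow> ('f ^ 'n) set" where
  "annihilator S = {x. \<forall>s\<in>S. vdot s x = 0}"

lemma vdot_simps:
  "vdot 0 x = 0" "vdot (s + t) x = vdot s x + vdot t x" "vdot (c *s s) x = c * vdot s x"
  by (simp_all add: vdot_def algebra_simps sum.distrib sum_distrib_left)

text \<open>For fixed \<open>x\<close>, the vectors \<open>s\<close> with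
  \<open>vdot s x = 0\<close> form a subspace.\<close>

lemma annihilator_span: "annihilator (vec.span S) = annihilator (S :: ('f::field ^ 'n) set)"
proof -
  have "vdot s x = 0" if s: "s \<in> vec.span S" and x: "x \<in> annihilator S" for s x
    using s
  proof (induction rule: vec.span_induct)
    case base
    then show ?case
      using x by (auto simp: annihilator_def vec.subspace_def vdot_simps)
  qed (use x in \<open>auto simp: annihilator_def\<close>)
  then show ?thesis
    by (auto simp: annihilator_def vec.span_base)
qed

text \<open>Extend a basis \<open>B\<close> of \<open>S\<close> to a basis of the whole space and
  use it as the rows of a matrix \<open>M\<close>. This injective \<open>M\<close> sends the
  annihilator to vectors whose coordinates at the rows from \<open>B\<close> are zero.\<close>

lemma dim_annihilator_le:
  fixes S :: "('f::field ^ 'n::finite) set"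
  shows "vec.dim (annihilator S) + vec.dim S \<le> CARD('n)"
proof -
  obtain B where B: "B \<subseteq> S" "vec.independent B" "S \<subseteq> vec.span B" "card B = vec.dim S"
    by (rule vec.basis_exists)
  obtain E where E: "B \<subseteq> E" "vec.independent E" "UNIV \<subseteq> vec.span E"
    by (rule vec.maximal_independent_subset_extend[OF subset_UNIV B(2)])
  have finE: "finite E"
    using E(2) vec.finiteI_independent by auto
  have "card E = CARD('n)"
    using vec.basis_card_eq_dim[OF subset_UNIV E(3,2)] by (simp add: card_cart_basis)
  then obtain r :: "'n \<Rightarrow> 'f ^ 'n" where r: "bij_betw r UNIV E"
    using finite_same_card_bij[of "UNIV :: 'n set" E] finE by auto
  define M where "M = (\<chi> i. r i)"
  define I where "I = r -` B"
  have Mx: "(M *v x) $ i = vdot (r i) x" for x i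
    by (simp add: M_def matrix_vector_mult_def vdot_def)
  have "rows M = E"
    using r unfolding bij_betw_def rows_def row_def M_def by (simp add: full_SetCompr_eq)
  then have "\<exists>A. A ** M = mat 1"
    using E(3) by (simp add: matrix_left_invertible_span_rows_gen top.extremum_unique)
  then have inj: "inj ((*v) M)"
    using matrix_left_invertible_injective by blast
  have cardI: "card I = card B"
    unfolding I_def using r E(1) by (intro card_vimage_inj) (auto simp: bij_betw_def)
  have "(*v) M ` annihilator S \<subseteq> {y. \<forall>i. i \<notin> - I \<longrightarrow> y $ i = 0}"
    using B(1) by (auto simp: Mx annihilator_def I_def)
  \<comment> \<open>Writing the vanishing condition with \<open>i \<notin> - I\<close> gives the set
    the shape that \<open>dim_substandard_cart\<close> measures.\<close>
  from vec.dim_subset[OF this] have "vec.dim ((*v) M ` annihilator S) \<le> card (- I)"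
    unfolding dim_substandard_cart .
  moreover have "vec.dim ((*v) M ` annihilator S) = vec.dim (annihilator S)"
    by (rule vec.dim_image_eq[OF matrix_vector_mul_linear_gen inj_on_subset[OF inj subset_UNIV]])
  moreover have "card (- I) + card I = CARD('n)"
    using card_Un_disjoint[of "- I" I] by (simp add: Compl_partition2)
  ultimately show ?thesis
    using cardI B(4) by simp
qed

lemma exists_matrix_range_kernel:
  fixes U :: "('f::field ^ 'a::finite) set" and W :: "('f ^ 'b::finite) set"
  assumes "vec.subspace U" "vec.subspace W" "vec.dim U = vec.dim W"
  shows "\<exists>X :: 'f ^ 'b ^ 'a. range ((*v) (transpose X)) \<subseteq> W \<and>
    {x. transpose X *v x = 0} = annihilator U"
proof -
  obtain B where B: "B \<subseteq> U" "vec.independent B" "U \<subseteq> vec.span B" "card B = vec.dim U"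
    by (rule vec.basis_exists)
  obtain C where C: "C \<subseteq> W" "vec.independent C" "W \<subseteq> vec.span C" "card C = vec.dim W"
    by (rule vec.basis_exists)
  have finB: "finite B" and finC: "finite C"
    using B(2) C(2) vec.finiteI_independent by auto
  obtain g where g: "bij_betw g B C"
    using finite_same_card_bij[OF finB finC] B(4) C(4) assms(3) by auto
  \<comment> \<open>A sum of outer products of matched basis vectors: the row action sends
    \<open>x\<close> to the combination of the \<open>g s\<close> with coefficients
    \<open>vdot s x\<close>.\<close>
  define X :: "'f ^ 'b ^ 'a" where "X = (\<chi> i j. \<Sum>s\<in>B. s $ i * g s $ j)"
  have X: "transpose X *v x = (\<Sum>s\<in>B. vdot s x *s g s)" for x
    unfolding vec_eq_iff
  proof
    fix j
    have "(transpose X *v x) $ j = (\<Sum>i\<in>UNIV. \<Sum>s\<in>B. s $ i * x $ i * g s $ j)"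
      by (simp add: X_def transpose_def matrix_vector_mult_def sum_distrib_right sum_distrib_left
          mult_ac)
    also have "\<dots> = (\<Sum>s\<in>B. \<Sum>i\<in>UNIV. s $ i * x $ i * g s $ j)"
      by (rule sum.swap)
    finally show "(transpose X *v x) $ j = (\<Sum>s\<in>B. vdot s x *s g s) $ j"
      by (simp add: vdot_def sum_distrib_right)
  qed
  have "transpose X *v x \<in> W" for x
    unfolding X using g C(1) assms(2)
    by (intro vec.subspace_sum vec.subspace_scale) (auto simp: bij_betw_def)
  moreover have "transpose X *v x = 0 \<longleftrightarrow> x \<in> annihilator U" for x
  proof -
    \<comment> \<open>Reindexing by \<open>C\<close> lets independence of \<open>C\<close> force
      every coefficient to vanish.\<close>
    have "transpose X *v x = (\<Sum>c\<in>C. vdot (inv_into B g c) x *s c)"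
      unfolding X using g
      by (subst sum.reindex_bij_betw[OF g, symmetric])
        (auto simp: bij_betw_def inv_into_f_f intro!: sum.cong)
    then have "transpose X *v x = 0 \<longleftrightarrow> (\<forall>c\<in>C. vdot (inv_into B g c) x = 0)"
      using vec.independentD[OF C(2) finC, of "\<lambda>c. vdot (inv_into B g c) x"] by auto
    also have "\<dots> \<longleftrightarrow> (\<forall>s\<in>B. vdot s x = 0)"
      using g by (auto simp: bij_betw_def inv_into_f_f)
    also have "\<dots> \<longleftrightarrow> x \<in> annihilator (vec.span B)"
      by (simp add: annihilator_span) (simp add: annihilator_def)
    also have "vec.span B = U"
      using B(1,3) assms(1) vec.span_minimal by blast
    finally show ?thesis .
  qed
  ultimately show ?thesis
    by (intro exI[of _ X]) auto
qed

text \<open>With \<open>H\<close> the kernel of the row action of \<open>X - Y\<close> and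
  \<open>S\<close> the sum of \<open>U\<close> and \<open>U'\<close>, the count is
  \<open>CARD('a)\<close> \<le> rank + dim \<open>H\<close> \<le> rank + dim
  (\<open>W \<inter> W'\<close>) + dim (\<open>annihilator S\<close>), where the last term is at
  most \<open>CARD('a)\<close> - dim \<open>S\<close>. The additive form avoids truncated
  subtraction.\<close>

lemma rank_diff_ge:
  fixes X Y :: "'f::field ^ 'b::finite ^ 'a::finite"
  assumes X: "range ((*v) (transpose X)) \<subseteq> W" "{x. transpose X *v x = 0} = annihilator U"
    and Y: "range ((*v) (transpose Y)) \<subseteq> W'" "{x. transpose Y *v x = 0} = annihilator U'"
  shows "vec.dim {x + y | x y. x \<in> U \<and> y \<in> U'} \<le> rank (X - Y) + vec.dim (W \<inter> W')"
proof -
  define H where "H = {x. transpose (X - Y) *v x = 0}"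
  define S where "S = {x + y | x y. x \<in> U \<and> y \<in> U'}"
  have diff: "transpose (X - Y) *v x = transpose X *v x - transpose Y *v x" for x
    by (simp add: vec_eq_iff transpose_def matrix_vector_mult_def sum_subtractf left_diff_distrib)
  have subH: "vec.subspace H"
    unfolding H_def
    by (rule vec.subspace_kernel)
  have "CARD('a) \<le> rank (X - Y) + vec.dim H"
    using dim_le_dim_image_plus_dim_kernel[OF matrix_vector_mul_linear_gen vec.subspace_UNIV,
        of "transpose (X - Y)"]
    by (simp add: rank_eq_dim_range_transpose H_def vec_dim_card card_cart_basis)
  moreover have "vec.dim H
      \<le> vec.dim ((*v) (transpose X) ` H) + vec.dim {x \<in> H. transpose X *v x = 0}"
    by (rule dim_le_dim_image_plus_dim_kernel[OF matrix_vector_mul_linear_gen subH])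
  moreover have "vec.dim ((*v) (transpose X) ` H) \<le> vec.dim (W \<inter> W')"
  proof (rule vec.dim_subset)
    show "(*v) (transpose X) ` H \<subseteq> W \<inter> W'"
    proof
      fix y assume "y \<in> (*v) (transpose X) ` H"
      then obtain x where x: "x \<in> H" "y = transpose X *v x"
        by blast
      then have "y = transpose Y *v x"
        by (simp add: H_def diff)
      with x(2) show "y \<in> W \<inter> W'"
        using X(1) Y(1) by blast
    qed
  qed
  \<comment> \<open>The two row actions agree on \<open>H\<close>, so a vector of \<open>H\<close>
    killed by one is killed by both; it then annihilates \<open>U\<close> and \<open>U'\<close>,
    hence their sum.\<close>
  moreover have "vec.dim {x \<in> H. transpose X *v x = 0} \<le> vec.dim (annihilator S)"
  proof (rule vec.dim_subset)
    have "x \<in> annihilator S" if "x \<in> annihilator U" "x \<in> annihilator U'" for x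
      using that by (auto simp: annihilator_def S_def vdot_simps)
    then show "{x \<in> H. transpose X *v x = 0} \<subseteq> annihilator S"
      unfolding X(2)[symmetric] Y(2)[symmetric] by (auto simp: H_def diff)
  qed
  moreover have "vec.dim (annihilator S) + vec.dim S \<le> CARD('a)"
    by (rule dim_annihilator_le)
  ultimately show ?thesis
    unfolding S_def by linarith
qed

text \<open>For equal dimensions, the dimensions of sum and intersection add up to
  \<open>2 * k\<close>, so either one alone determines the distance. The first form is used for the
  row side of the pairing, the second for the range side.\<close>

lemma subspace_dist_eqs:
  assumes "vec.subspace U" "vec.subspace W" "vec.dim U = k" "vec.dim W = k"
  shows "subspace_dist U W + 2 * k = 2 * vec.dim {x + y | x y. x \<in> U \<and> y \<in> W}"
    and "subspace_dist U W + 2 * vec.dim (U \<inter> W) = 2 * k"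
proof -
  have "vec.dim (U \<inter> W) \<le> k"
    using assms(3) by (metis inf_le1 vec.dim_subset)
  then show "subspace_dist U W + 2 * k = 2 * vec.dim {x + y | x y. x \<in> U \<and> y \<in> W}"
    and "subspace_dist U W + 2 * vec.dim (U \<inter> W) = 2 * k"
    using vec.dim_sums_Int[OF assms(1,2)] assms(3,4) unfolding subspace_dist_def by linarith+
qed

lemma A_code_attained:
  "\<exists>C :: ('f::{field,finite} ^ 'v::finite) set set.
    const_dim_code d k C \<and> card C = A_code TYPE('f) TYPE('v) d k"
  using Max_in[OF A_code_range_ok[where 'f='f and 'v='v and d=d and k=k]]
  unfolding A_code_def by auto

lemma const_dim_code_subset: "const_dim_code d k C \<Longrightarrow> D \<subseteq> C \<Longrightarrow> const_dim_code d k D"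
  unfolding const_dim_code_def by blast

lemma card_le_Lambda:
  fixes C :: "('f::{field,finite} ^ 'b::finite ^ 'a::finite) set"
  assumes "bounded_rank_code d u C"
  shows "card C \<le> Lambda TYPE('f) TYPE('a) TYPE('b) d u"
  unfolding Lambda_def using assms by (intro Max_ge Lambda_range_ok) auto

text \<open>Any bijection \<open>p\<close> works: distinct \<open>U\<close>, \<open>V\<close> have
  distinct partners, so both distance bounds hold at once. Adding the two identities for the
  distances gives 2 rank \<ge> \<open>d\<^sub>1 + d\<^sub>2\<close> \<ge>
  \<open>2 * d\<close>.\<close>

lemma card_le_Lambda_of_paired_codes:
  fixes C :: "('f::{field,finite} ^ 'a::finite) set set" and D :: "('f ^ 'b::finite) set set"
  assumes C: "const_dim_code d\<^sub>1 u C" and D: "const_dim_code d\<^sub>2 u D" and "card C = card D"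
    and d: "d > 0" "2 * d \<le> d\<^sub>1 + d\<^sub>2"
  shows "card C \<le> Lambda TYPE('f) TYPE('a) TYPE('b) d u"
proof -
  obtain p where p: "bij_betw p C D"
    using finite_same_card_bij[of C D] assms(3) by auto
  have inj_p: "inj_on p C" and pD: "p U \<in> D" if "U \<in> C" for U
    using p that by (auto simp: bij_betw_def)
  have sC: "vec.subspace U" "vec.dim U = u" if "U \<in> C" for U
    using C that by (auto simp: const_dim_code_def)
  have sD: "vec.subspace W" "vec.dim W = u" if "W \<in> D" for W
    using D that by (auto simp: const_dim_code_def)
  have "\<forall>U\<in>C. \<exists>X :: 'f ^ 'b ^ 'a. range ((*v) (transpose X)) \<subseteq> p U \<and>
      {x. transpose X *v x = 0} = annihilator U"
    by (intro ballI exists_matrix_range_kernel) (simp_all add: sC sD pD)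
  then obtain X :: "('f ^ 'a) set \<Rightarrow> 'f ^ 'b ^ 'a" where
    X: "range ((*v) (transpose (X U))) \<subseteq> p U" "{x. transpose (X U) *v x = 0} = annihilator U"
    if "U \<in> C" for U
    unfolding bchoice_iff by blast
  have rank_ge: "d \<le> rank (X U - X V)" if "U \<in> C" "V \<in> C" "U \<noteq> V" for U V
  proof -
    have "p U \<noteq> p V"
      using inj_p that by (auto simp: inj_on_def)
    then have "d\<^sub>1 \<le> subspace_dist U V" "d\<^sub>2 \<le> subspace_dist (p U) (p V)"
      using C D that pD by (auto simp: const_dim_code_def)
    moreover have "vec.dim {x + y | x y. x \<in> U \<and> y \<in> V} \<le> rank (X U - X V) + vec.dim (p U \<inter> p V)"
      using that by (intro rank_diff_ge X)
    moreover have "subspace_dist U V + 2 * u = 2 * vec.dim {x + y | x y. x \<in> U \<and> y \<in> V}"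
      using that by (intro subspace_dist_eqs sC)
    moreover have "subspace_dist (p U) (p V) + 2 * vec.dim (p U \<inter> p V) = 2 * u"
      using that by (intro subspace_dist_eqs sD pD)
    ultimately show ?thesis
      using d(2) by linarith
  qed
  have "rank (X U) \<le> u" if "U \<in> C" for U
    using vec.dim_subset[OF X(1)[OF that]] sD(2)[OF pD[OF that]]
    by (simp add: rank_eq_dim_range_transpose)
  then have "bounded_rank_code d u (X ` C)"
    using rank_ge by (auto simp: bounded_rank_code_def)
  \<comment> \<open>Since \<open>d\<close> is positive, distinct codewords cannot share a matrix:
    the difference would have rank 0. So the matrix code is as large as \<open>C\<close>.\<close>
  moreover have "inj_on X C"
  proof (rule inj_onI, rule ccontr)
    fix U V assume UV: "U \<in> C" "V \<in> C" "X U = X V" "U \<noteq> V"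
    have "rank (0 :: 'f ^ 'b ^ 'a) = 0"
      by (auto simp: row_rank_def_gen rows_def row_def zero_vec_def)
    then show False
      using rank_ge[OF UV(1,2,4)] UV(3) d(1) by simp
  qed
  ultimately show ?thesis
    using card_le_Lambda[of d u "X ` C"] by (simp add: card_image)
qed

theorem theorem15:
  fixes d d\<^sub>1 d\<^sub>2 u :: nat
  assumes "d > 0" and "d\<^sub>1 > 0" and "d\<^sub>2 > 0" and "u > 0"
    and "2 * d \<le> d\<^sub>1 + d\<^sub>2"
  shows "Lambda TYPE('f::{field,finite}) TYPE('a::finite) TYPE('b::finite) d u
    \<ge> min (A_code TYPE('f) TYPE('a) d\<^sub>1 u) (A_code TYPE('f) TYPE('b) d\<^sub>2 u)"
proof -
  define m where "m = min (A_code TYPE('f) TYPE('a) d\<^sub>1 u) (A_code TYPE('f) TYPE('b) d\<^sub>2 u)"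
  obtain C :: "('f ^ 'a) set set" where C: "const_dim_code d\<^sub>1 u C" "m \<le> card C"
    using A_code_attained[where 'f='f and 'v='a and d=d\<^sub>1 and k=u] unfolding m_def by auto
  obtain D :: "('f ^ 'b) set set" where D: "const_dim_code d\<^sub>2 u D" "m \<le> card D"
    using A_code_attained[where 'f='f and 'v='b and d=d\<^sub>2 and k=u] unfolding m_def by auto
  \<comment> \<open>Both optimal codes are cut down to the common size \<open>m\<close>, so that
    they can be paired bijectively; subsets keep the distance property.\<close>
  obtain C' where C': "C' \<subseteq> C" "card C' = m"
    using C(2) obtain_subset_with_card_n by metis
  obtain D' where D': "D' \<subseteq> D" "card D' = m"
    using D(2) obtain_subset_with_card_n by metis
  have "card C' \<le> Lambda TYPE('f) TYPE('a) TYPE('b) d u"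
    using const_dim_code_subset[OF C(1) C'(1)] const_dim_code_subset[OF D(1) D'(1)] C'(2) D'(2)
      assms(1,5)
    by (intro card_le_Lambda_of_paired_codes) auto
  then show ?thesis
    using C'(2) by (simp add: m_def)
qed

end
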